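(* Let $X$ be a Euclidean space, let $I$ and $J$ be nonempty finite index sets, let $(A_i)_{i\in I}$ and $(B_j)_{j\in J}$ be families of nonempty closed convex subsets of $X$, and set $A := \bigcup_{i\in I}A_i$ and $B := \bigcup_{j\in J}B_j$. Let $b_{-1}\in X$ and let $(a_n)_{n\in\mathbb N}$ and $(b_n)_{n\in\mathbb N}$ be sequences such that, for every $n\in\mathbb N$, $a_n\in P_A(b_{n-1})$ and $b_n\in P_B(a_n)$. Suppose that $(a_n)_{n\in\mathbb N}$ and $(b_n)_{n\in\mathbb N}$ are bounded, and that $b_n-a_n\to 0$ and $a_{n+1}-b_n\to 0$. Then there exists a point $c\in A\cap B$ such that $a_n\to c$ and $b_n\to c$.
   Context: $\mathbb N=\{0,1,2,\dots\}$. A Euclidean space is a finite-dimensional real inner product space, with induced norm $\|\cdot\|$. For a nonempty subset $C$ of $X$ and $y\in X$, the projection of $y$ onto $C$ is the (set-valued) $P_C(y) := \{c\in C : \|y-c\|=\inf_{z\in C}\|y-z\|\}$. *)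

theory Defs
  imports "HOL-Analysis.Analysis"
begin

(* Set-valued projection.  For nonempty C the infimum is over a nonempty set of reals
   that is bounded below, so Inf on the reals has its usual meaning; for C = {} the
   projection is empty.  The library's closest_point is single-valued (Hilbert choice)
   and so does not fit unions of convex sets. *)
definition proj_set :: "'a::real_normed_vector set \<Rightarrow> 'a \<Rightarrow> 'a set" where
  "proj_set C y = {c \<in> C. norm (y - c) = (INF z\<in>C. norm (y - z))}"

(* A Euclidean space is a real inner product space satisfying this predicate.
   Unlike class euclidean_space, it admits the zero-dimensional space. *)
definition finite_dimensional :: "'a::real_vector itself \<Rightarrow> bool" where
  "finite_dimensional _ \<longleftrightarrow> (\<exists>S :: 'a set. finite S \<and> span S = UNIV)"

end

theory Submission
  imports Defs
begin

text \<open>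
  A projection onto a finite union of closed convex sets behaves, near any point \<open>c\<close> of the
  union, like a projection onto a single convex set that contains \<open>c\<close>: the members of the
  union that miss \<open>c\<close> stay at a positive distance from it, so a point close to \<open>c\<close> is projected
  into a member through \<open>c\<close>, and projecting onto that member does not increase the distance to
  \<open>c\<close>. This is \<open>proj_set_UN_convex_local_fejer\<close>.

  Both sequences lie in closed sets and their difference tends to \<open>0\<close>, so every cluster point
  \<open>c\<close> of \<open>b\<close> is a common point of the two unions; one exists since bounded sequences
  in a finite-dimensional space have convergent subsequences. As soon as some \<open>b n\<close> is close enough
  to \<open>c\<close>, the local property holds for both unions, the next iterates are at least as close to
  \<open>c\<close>, and it keeps applying forever. The distance to \<open>c\<close> is then eventually nonincreasing along
  the iteration; as it becomes arbitrarily small along a subsequence, the whole iteration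
  converges to \<open>c\<close>.
\<close>

text \<open>
  The space need not be an instance of \<^class>\<open>euclidean_space\<close>, so Bolzano--Weierstrass is
  obtained from the scalar case, applied to the coordinates in an orthogonal basis.
\<close>

lemma finite_dimensional_bounded_imp_convergent_subsequence:
  fixes f :: "nat \<Rightarrow> 'a::real_inner"
  assumes "finite_dimensional TYPE('a)" and "bounded (range f)"
  obtains l r where "strict_mono r" and "(f \<circ> r) \<longlonglongrightarrow> l"
proof -
  obtain S :: "'a set" where "finite S" "span S = UNIV"
    using assms(1) by (auto simp: finite_dimensional_def)
  with basis_orthogonal obtain D :: "'a set"
    where D: "finite D" "span D = UNIV" "pairwise orthogonal D"
    by metis
  \<comment> \<open>The coordinates divide by squared norms of basis vectors, so a zero vector must go.\<close>
  define C where "C = D - {0}"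
  have C: "finite C" "span C = UNIV" "pairwise orthogonal C" "0 \<notin> C"
    using D by (auto simp: C_def pairwise_def)
  define coord :: "'a \<Rightarrow> 'a \<Rightarrow> real" where "coord x t = (x \<bullet> t) / (t \<bullet> t)" for x t
  define comb :: "('a \<Rightarrow> real) \<Rightarrow> 'a" where "comb u = (\<Sum>t\<in>C. u t *\<^sub>R t)" for u
  have coord_comb: "coord (comb u) k = u k" if "k \<in> C" for u k
  proof -
    have "comb u \<bullet> k = (\<Sum>t\<in>C. if t = k then u k * (k \<bullet> k) else 0)"
      unfolding comb_def inner_sum_left
      using C(3) that by (intro sum.cong) (auto simp: pairwise_def orthogonal_def)
    also have "\<dots> = u k * (k \<bullet> k)"
      using C(1) that by simp
    finally show ?thesis
      using C(4) that by (auto simp: coord_def)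
  qed
  have comb_coord: "comb (coord x) = x" for x
  proof -
    obtain u where x: "x = comb u"
      using span_finite[OF C(1)] C(2) by (auto simp: comb_def)
    have "(\<Sum>t\<in>C. coord (comb u) t *\<^sub>R t) = (\<Sum>t\<in>C. u t *\<^sub>R t)"
      by (simp add: coord_comb)
    then show ?thesis
      unfolding x by (simp add: comb_def)
  qed
  have bdd: "bounded ((\<lambda>x. coord x k) ` range f)" for k
    using bounded_linear_image[OF assms(2), of "\<lambda>x. coord x k"]
    by (simp add: coord_def divide_inverse bounded_linear_inner_left
        bounded_linear_mult_const)
  obtain l r where r: "strict_mono r"
    and lim: "\<And>\<epsilon>. \<epsilon> > 0 \<Longrightarrow>
      eventually (\<lambda>n. \<forall>t\<in>C. dist (coord (f (r n)) t) (coord l t) < \<epsilon>) sequentially"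
    using compact_lemma_general[of C coord f comb, OF C(1) bdd coord_comb comb_coord]
    by blast
  have "(\<lambda>n. coord (f (r n)) t) \<longlonglongrightarrow> coord l t" if "t \<in> C" for t
    using that by (intro tendstoI eventually_mono[OF lim]) auto
  then have "(\<lambda>n. comb (coord (f (r n)))) \<longlonglongrightarrow> comb (coord l)"
    unfolding comb_def by (intro tendsto_sum tendsto_scaleR tendsto_const) auto
  then have "(f \<circ> r) \<longlonglongrightarrow> l"
    by (simp add: comb_coord o_def)
  with r show ?thesis
    by (rule that)
qed

lemma proj_setD:
  assumes "p \<in> proj_set C y"
  shows "p \<in> C" and "\<And>z. z \<in> C \<Longrightarrow> dist y p \<le> dist y z"
proof -
  show "p \<in> C"
    using assms by (simp add: proj_set_def)
  have "bdd_below ((\<lambda>z. norm (y - z)) ` C)"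
    by (rule bdd_belowI2[of _ 0]) simp
  then show "dist y p \<le> dist y z" if "z \<in> C" for z
    using assms that by (auto simp: proj_set_def dist_norm intro: cINF_lower)
qed

text \<open>
  The vectors from the nearest point \<open>p\<close> to \<open>y\<close> and to \<open>c\<close> enclose an angle of at least a
  right angle, so the side of the triangle from \<open>y\<close> to \<open>c\<close> opposite to it is the longest one.
\<close>

lemma dist_closest_point_le_dist:
  fixes y :: "'a::real_inner"
  assumes "convex S" "closed S" "p \<in> S" "c \<in> S" and "\<And>z. z \<in> S \<Longrightarrow> dist y p \<le> dist y z"
  shows "dist p c \<le> dist y c"
proof -
  have "(y - p) \<bullet> (c - p) \<le> 0"
    using any_closest_point_dot[of S p c y] assms by blast
  moreover have "(norm (y - c))\<^sup>2 = (norm (y - p))\<^sup>2 + (norm (p - c))\<^sup>2 - 2 * ((y - p) \<bullet> (c - p))"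
    by (simp add: power2_norm_eq_inner algebra_simps inner_commute)
  ultimately have "(norm (p - c))\<^sup>2 \<le> (norm (y - c))\<^sup>2"
    by (smt (verit) zero_le_power2)
  then show ?thesis
    by (simp add: dist_norm)
qed

text \<open>
  The radius comes from the union of those members that miss \<open>c\<close>, which is closed because the
  index set is finite. It is halved because the projection \<open>p\<close> of \<open>y\<close> satisfies
  \<open>dist y p \<le> dist y c\<close>, so a priori \<open>p\<close> is only within twice the distance from \<open>y\<close> to \<open>c\<close>.
\<close>

lemma proj_set_UN_convex_local_fejer:
  fixes A :: "'i \<Rightarrow> 'a::real_inner set"
  assumes "finite I" and A: "\<And>i. i \<in> I \<Longrightarrow> closed (A i) \<and> convex (A i)"
    and c: "c \<in> (\<Union>i\<in>I. A i)"
  obtains e where "e > 0"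
    and "\<And>y p. dist y c < e \<Longrightarrow> p \<in> proj_set (\<Union>i\<in>I. A i) y \<Longrightarrow> dist p c \<le> dist y c"
proof -
  define F where "F = (\<Union>i\<in>{i\<in>I. c \<notin> A i}. A i)"
  have "closed F"
    unfolding F_def using assms(1) A by (intro closed_UN) auto
  then have "open (- F)"
    by (rule open_Compl)
  moreover have "c \<in> - F"
    by (auto simp: F_def)
  ultimately obtain d where d: "d > 0" "ball c d \<subseteq> - F"
    by (meson openE)
  have "dist p c \<le> dist y c" if y: "dist y c < d / 2" and p: "p \<in> proj_set (\<Union>i\<in>I. A i) y" for y p
  proof -
    obtain i where i: "i \<in> I" "p \<in> A i"
      using proj_setD(1)[OF p] by blast
    have "dist y p \<le> dist y c"
      using proj_setD(2)[OF p c] .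
    with y have "p \<in> ball c d"
      using dist_triangle[of c p y] by (simp add: dist_commute)
    with d(2) i have "c \<in> A i"
      by (auto simp: F_def)
    with i A[OF i(1)] show ?thesis
      by (intro dist_closest_point_le_dist[of "A i"]) (auto intro: proj_setD(2)[OF p])
  qed
  with that[of "d / 2"] d(1) show ?thesis
    by simp
qed

text \<open>
  Every ball around \<open>c\<close> of radius at most \<open>e\<close> traps the sequence once it has been entered, and
  the subsequence enters each of them.
\<close>

lemma LIMSEQ_if_cluster_point_local_fejer:
  fixes x :: "nat \<Rightarrow> 'a::metric_space"
  assumes "(x \<circ> r) \<longlonglongrightarrow> c" and "e > 0"
    and step: "\<And>n. dist (x n) c < e \<Longrightarrow> dist (x (Suc n)) c \<le> dist (x n) c"
  shows "x \<longlonglongrightarrow> c"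
proof (rule metric_LIMSEQ_I)
  fix d :: real
  assume "d > 0"
  then have "eventually (\<lambda>k. dist (x (r k)) c < min d e) sequentially"
    using tendstoD[OF assms(1), of "min d e"] assms(2) by simp
  then obtain N where N: "dist (x N) c < min d e"
    by (auto simp: eventually_sequentially)
  have "dist (x n) c < min d e" if "n \<ge> N" for n
    using that
  proof (induction n rule: dec_induct)
    case (step n)
    then show ?case
      using assms(3)[of n] by simp
  qed (rule N)
  then show "\<exists>N. \<forall>n\<ge>N. dist (x n) c < d"
    by auto
qed

theorem theorem3p4:
  fixes I :: "'i set" and J :: "'j set"
    and A :: "'i \<Rightarrow> 'a::real_inner set" and B :: "'j \<Rightarrow> 'a set"
    and b_init :: 'a and a b :: "nat \<Rightarrow> 'a"
  assumes "finite_dimensional TYPE('a)"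
    and "finite I" and "I \<noteq> {}"
    and "finite J" and "J \<noteq> {}"
    and "\<And>i. i \<in> I \<Longrightarrow> A i \<noteq> {} \<and> closed (A i) \<and> convex (A i)"
    and "\<And>j. j \<in> J \<Longrightarrow> B j \<noteq> {} \<and> closed (B j) \<and> convex (B j)"
    and "a 0 \<in> proj_set (\<Union>i\<in>I. A i) b_init"
    and "\<And>n. a (Suc n) \<in> proj_set (\<Union>i\<in>I. A i) (b n)"
    and "\<And>n. b n \<in> proj_set (\<Union>j\<in>J. B j) (a n)"
    and "bounded (range a)" and "bounded (range b)"
    and "(\<lambda>n. b n - a n) \<longlonglongrightarrow> 0"
    and "(\<lambda>n. a (Suc n) - b n) \<longlonglongrightarrow> 0"
  shows "\<exists>c \<in> (\<Union>i\<in>I. A i) \<inter> (\<Union>j\<in>J. B j). a \<longlonglongrightarrow> c \<and> b \<longlonglongrightarrow> c"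
proof -
  define UA where "UA = (\<Union>i\<in>I. A i)"
  define UB where "UB = (\<Union>j\<in>J. B j)"
  have "closed UA" "closed UB"
    unfolding UA_def UB_def using assms(2,4,6,7) by auto
  have a_proj: "a (Suc n) \<in> proj_set UA (b n)" and b_proj: "b n \<in> proj_set UB (a n)" for n
    using assms(9,10) by (auto simp: UA_def UB_def)
  have a_in: "a n \<in> UA" for n
    using assms(8) a_proj by (cases n) (auto simp: UA_def dest: proj_setD(1))
  have b_in: "b n \<in> UB" for n
    using b_proj proj_setD(1) by blast
  obtain c r where r: "strict_mono r" and br: "(b \<circ> r) \<longlonglongrightarrow> c"
    using finite_dimensional_bounded_imp_convergent_subsequence[OF assms(1,12)] by blast
  have ar: "(a \<circ> r) \<longlonglongrightarrow> c"
    using tendsto_diff[OF br LIMSEQ_subseq_LIMSEQ[OF assms(13) r]] by (simp add: o_def)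
  have cA: "c \<in> UA"
    using closed_sequentially[OF \<open>closed UA\<close> _ ar] a_in by simp
  have cB: "c \<in> UB"
    using closed_sequentially[OF \<open>closed UB\<close> _ br] b_in by simp
  obtain e1 where e1: "e1 > 0"
    "\<And>y p. dist y c < e1 \<Longrightarrow> p \<in> proj_set UA y \<Longrightarrow> dist p c \<le> dist y c"
    using proj_set_UN_convex_local_fejer[of I A c] assms(2,6) cA unfolding UA_def by metis
  obtain e2 where e2: "e2 > 0"
    "\<And>y p. dist y c < e2 \<Longrightarrow> p \<in> proj_set UB y \<Longrightarrow> dist p c \<le> dist y c"
    using proj_set_UN_convex_local_fejer[of J B c] assms(4,7) cB unfolding UB_def by metis
  have "b \<longlonglongrightarrow> c"
  proof (rule LIMSEQ_if_cluster_point_local_fejer[OF br])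
    show "min e1 e2 > 0"
      using e1(1) e2(1) by simp
    fix n
    assume near: "dist (b n) c < min e1 e2"
    then have "dist (a (Suc n)) c \<le> dist (b n) c"
      using e1(2)[OF _ a_proj] by simp
    moreover from this near have "dist (b (Suc n)) c \<le> dist (a (Suc n)) c"
      using e2(2)[OF _ b_proj] by simp
    ultimately show "dist (b (Suc n)) c \<le> dist (b n) c"
      by simp
  qed
  moreover from this have "a \<longlonglongrightarrow> c"
    using tendsto_diff[OF _ assms(13)] by fastforce
  ultimately show ?thesis
    using cA cB unfolding UA_def UB_def by blast
qed

end
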